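(* The system of equations $(A_1f)(t)=g(t)$, $(A_1g)(t)=f(t)$, $t\in[0,1]$, has no solution $(f,g)\in (C_0^+[0,1])^2$ with $f\neq g$.
   Context: Let $J\in\mathbb R\setminus\{0\}$, $\beta>0$, let $\xi:[0,1]^2\to\mathbb R$, $(t,u)\mapsto\xi_{t,u}$, be a bounded measurable function, and put $K(t,u)=\exp(J\beta\xi_{t,u})$, $t,u\in[0,1]$. The linear operator $(Wf)(t)=\int_0^1K(t,u)f(u)\,du$ is taken to act from $C[0,1]$ to $C[0,1]$. $C_0^+[0,1]$ is the set of continuous functions $\varphi:[0,1]\to[0,\infty)$ that are not identically zero. For $f\in C_0^+[0,1]$ the operator $A_1$ is defined by $(A_1f)(t)=\dfrac{(Wf)(t)}{(Wf)(0)}$, $t\in[0,1]$. *)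

theory Defs
  imports "HOL-Analysis.Analysis"
begin

text \<open>
  Functions on the unit interval are represented by total functions on the reals of
  which only the values on \<open>{0..1}\<close> matter.
\<close>

definition exp_kernel :: "real \<Rightarrow> real \<Rightarrow> (real \<Rightarrow> real \<Rightarrow> real) \<Rightarrow> real \<Rightarrow> real \<Rightarrow> real" where
  "exp_kernel J \<beta> \<xi> t u = exp (J * \<beta> * \<xi> t u)"

definition W :: "(real \<Rightarrow> real \<Rightarrow> real) \<Rightarrow> (real \<Rightarrow> real) \<Rightarrow> real \<Rightarrow> real" where
  "W K f t = (\<integral>u. K t u * f u \<partial>lebesgue_on {0..1})"

text \<open>
  The integrability clause says that \<open>W K f t\<close> is a genuine integral at every \<open>t\<close>:
  a section of a Lebesgue measurable function on the square may fail to be measurable for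
  a null set of \<open>t\<close>, and there the library's integral would be \<open>0\<close> by convention.
  For Borel measurable bounded \<open>K\<close> the clause holds automatically.
\<close>

definition W_acts_on_C :: "(real \<Rightarrow> real \<Rightarrow> real) \<Rightarrow> bool" where
  "W_acts_on_C K \<longleftrightarrow>
     (\<forall>f. continuous_on {0..1} f \<longrightarrow>
        (\<forall>t\<in>{0..1}. integrable (lebesgue_on {0..1}) (\<lambda>u. K t u * f u)) \<and>
        continuous_on {0..1} (W K f))"

definition C0_plus :: "(real \<Rightarrow> real) set" where
  "C0_plus = {\<phi>. continuous_on {0..1} \<phi> \<and> (\<forall>t\<in>{0..1}. 0 \<le> \<phi> t) \<and>
                 \<not> (\<forall>t\<in>{0..1}. \<phi> t = 0)}"

definition A1 :: "(real \<Rightarrow> real \<Rightarrow> real) \<Rightarrow> (real \<Rightarrow> real) \<Rightarrow> real \<Rightarrow> real" where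
  "A1 K f t = W K f t / W K f 0"

end

theory Submission
  imports Defs
begin

text \<open>
  Here \<open>W f\<close> and \<open>W g\<close> are positive multiples \<open>a g\<close> and \<open>b f\<close>, and \<open>f 0 = g 0 = 1\<close>.
  Let \<open>c\<close> and \<open>d\<close> be the maximum and the minimum of \<open>g / f\<close>. If \<open>f \<noteq> g\<close>, neither of the
  nonnegative functions \<open>c f - g\<close> and \<open>g - d f\<close> vanishes identically, so \<open>W\<close> maps both to
  strictly positive functions, i.e. \<open>c a g > b f\<close> and \<open>b f > d a g\<close>. At a point where
  \<open>g = d f\<close> the first gives \<open>a c d > b\<close>, at a point where \<open>g = c f\<close> the second gives
  \<open>b > a c d\<close>.
\<close>

text \<open>With \<open>B\<close> a bound for \<open>\<bar>\<xi>\<bar>\<close>, the exponent never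
  drops below \<open>- (\<bar>J * \<beta>\<bar> * B)\<close>. This uniform positive bound is what
  makes \<open>W\<close> strictly positive on \<open>C0_plus\<close>.\<close>

lemma exp_kernel_lower_bound:
  assumes "bounded ((\<lambda>(t, u). \<xi> t u) ` ({0..1} \<times> {0..1}))"
  obtains k where "k > 0"
    "\<And>t u. t \<in> {0..1} \<Longrightarrow> u \<in> {0..1} \<Longrightarrow> k \<le> exp_kernel J \<beta> \<xi> t u"
proof -
  obtain B where B: "\<And>t u. t \<in> {0..1} \<Longrightarrow> u \<in> {0..1} \<Longrightarrow> \<bar>\<xi> t u\<bar> \<le> B"
    using assms unfolding bounded_iff by fastforce
  show thesis
  proof (rule that)
    show "exp (- (\<bar>J * \<beta>\<bar> * B)) > 0" by simp
    fix t u :: real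
    assume "t \<in> {0..1}" "u \<in> {0..1}"
    then have "\<bar>J * \<beta> * \<xi> t u\<bar> \<le> \<bar>J * \<beta>\<bar> * B"
      using B by (simp add: abs_mult mult_left_mono)
    then show "exp (- (\<bar>J * \<beta>\<bar> * B)) \<le> exp_kernel J \<beta> \<xi> t u"
      unfolding exp_kernel_def by simp
  qed
qed

lemma W_diff_scale:
  assumes "W_acts_on_C K" "continuous_on {0..1} f" "continuous_on {0..1} g" "t \<in> {0..1}"
  shows "W K (\<lambda>u. p * f u - q * g u) t = p * W K f t - q * W K g t"
proof -
  have int: "integrable (lebesgue_on {0..1}) (\<lambda>u. K t u * f u)"
    "integrable (lebesgue_on {0..1}) (\<lambda>u. K t u * g u)"
    using assms unfolding W_acts_on_C_def by auto
  have "W K (\<lambda>u. p * f u - q * g u) t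
      = (\<integral>u. p * (K t u * f u) - q * (K t u * g u) \<partial>lebesgue_on {0..1})"
    unfolding W_def by (simp add: algebra_simps)
  also have "\<dots> = p * W K f t - q * W K g t"
    unfolding W_def using int by (subst Bochner_Integration.integral_diff) auto
  finally show ?thesis .
qed

text \<open>A continuous nonnegative function that is nonzero somewhere has positive integral, and
  the lower bound \<open>k\<close> on the kernel section makes \<open>W K h t\<close> at least
  \<open>k\<close> times that integral.\<close>

lemma W_pos:
  assumes "W_acts_on_C K" and k: "k > 0" "\<And>u. u \<in> {0..1} \<Longrightarrow> k \<le> K t u"
    and h: "h \<in> C0_plus" and t: "t \<in> {0..1}"
  shows "W K h t > 0"
proof -
  have cont: "continuous_on {0..1} h" and nonneg: "\<And>u. u \<in> {0..1} \<Longrightarrow> 0 \<le> h u"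
    and nonzero: "\<exists>u\<in>{0..1}. h u \<noteq> 0"
    using h unfolding C0_plus_def by auto
  have inth: "integrable (lebesgue_on {0..1}) h"
    using cont by (rule continuous_imp_integrable_real)
  have "integral {0..1} h \<noteq> 0"
    using integral_eq_0_iff[OF cont] nonneg nonzero by auto
  moreover have "integral {0..1} h \<ge> 0"
    by (rule integral_nonneg) (auto intro: integrable_continuous_real cont nonneg)
  ultimately have "0 < k * (\<integral>u. h u \<partial>lebesgue_on {0..1})"
    using k inth by (simp add: lebesgue_integral_eq_integral)
  also have "\<dots> = (\<integral>u. k * h u \<partial>lebesgue_on {0..1})"
    by simp
  also have "\<dots> \<le> W K h t"
    unfolding W_def
  proof (rule integral_mono)
    show "integrable (lebesgue_on {0..1}) (\<lambda>u. K t u * h u)"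
      using assms(1) cont t unfolding W_acts_on_C_def by blast
  qed (use inth k nonneg in \<open>auto intro: mult_right_mono\<close>)
  finally show ?thesis .
qed

theorem theorem3p2:
  fixes J \<beta> :: real and \<xi> :: "real \<Rightarrow> real \<Rightarrow> real"
  assumes "J \<noteq> 0" and "\<beta> > 0"
    and "(\<lambda>(t, u). \<xi> t u) \<in> borel_measurable (lebesgue_on ({0..1} \<times> {0..1}))"
    and "bounded ((\<lambda>(t, u). \<xi> t u) ` ({0..1} \<times> {0..1}))"
    and "W_acts_on_C (exp_kernel J \<beta> \<xi>)"
  shows "\<not> (\<exists>f\<in>C0_plus. \<exists>g\<in>C0_plus.
            (\<forall>t\<in>{0..1}. A1 (exp_kernel J \<beta> \<xi>) f t = g t) \<and>
            (\<forall>t\<in>{0..1}. A1 (exp_kernel J \<beta> \<xi>) g t = f t) \<and>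
            (\<exists>t\<in>{0..1}. f t \<noteq> g t))"
proof
  define K where "K = exp_kernel J \<beta> \<xi>"
  assume "\<exists>f\<in>C0_plus. \<exists>g\<in>C0_plus.
            (\<forall>t\<in>{0..1}. A1 (exp_kernel J \<beta> \<xi>) f t = g t) \<and>
            (\<forall>t\<in>{0..1}. A1 (exp_kernel J \<beta> \<xi>) g t = f t) \<and>
            (\<exists>t\<in>{0..1}. f t \<noteq> g t)"
  then obtain f g where f: "f \<in> C0_plus" and g: "g \<in> C0_plus"
    and A1f: "\<And>t. t \<in> {0..1} \<Longrightarrow> A1 K f t = g t"
    and A1g: "\<And>t. t \<in> {0..1} \<Longrightarrow> A1 K g t = f t"
    and ne: "\<exists>t\<in>{0..1}. f t \<noteq> g t"
    unfolding K_def by blast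
  have acts: "W_acts_on_C K" using assms(5) by (simp add: K_def)
  obtain k where k: "k > 0" "\<And>t u. t \<in> {0..1} \<Longrightarrow> u \<in> {0..1} \<Longrightarrow> k \<le> K t u"
    using exp_kernel_lower_bound[OF assms(4)] unfolding K_def by metis
  have pos: "W K h t > 0" if "h \<in> C0_plus" "t \<in> {0..1}" for h t
    using W_pos[OF acts] k that by blast
  define a b where "a = W K f 0" and "b = W K g 0"
  have a: "a > 0" and b: "b > 0" unfolding a_def b_def using pos f g by auto
  have Wf: "W K f t = a * g t" and Wg: "W K g t = b * f t" if "t \<in> {0..1}" for t
    using A1f[OF that] A1g[OF that] a b unfolding A1_def a_def b_def by (auto simp: field_simps)
  \<comment> \<open>Membership in \<open>C0_plus\<close> allows zeros, but \<open>b * f t\<close> is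
    a value of \<open>W K g\<close>, hence positive; so the quotient \<open>g / f\<close> is well
    defined and continuous.\<close>
  have fpos: "f t > 0" if "t \<in> {0..1}" for t
    using pos[OF g that] Wg[OF that] b by (simp add: zero_less_mult_iff)
  \<comment> \<open>At \<open>0\<close> the relations read \<open>a = a * g 0\<close> and
    \<open>b = b * f 0\<close>.\<close>
  have f0: "f 0 = 1" and g0: "g 0 = 1"
    using Wf[of 0] Wg[of 0] a b unfolding a_def b_def by auto
  have cf: "continuous_on {0..1} f" and cg: "continuous_on {0..1} g"
    using f g unfolding C0_plus_def by auto
  have cq: "continuous_on {0..1} (\<lambda>t. g t / f t)"
    using cf cg fpos by (intro continuous_intros) force+
  obtain s where s: "s \<in> {0..1}" "\<And>t. t \<in> {0..1} \<Longrightarrow> g t / f t \<le> g s / f s"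
    using continuous_attains_sup[OF compact_Icc _ cq] by auto
  obtain r where r: "r \<in> {0..1}" "\<And>t. t \<in> {0..1} \<Longrightarrow> g r / f r \<le> g t / f t"
    using continuous_attains_inf[OF compact_Icc _ cq] by auto
  define c d where "c = g s / f s" and "d = g r / f r"
  have gs: "g s = c * f s" and gr: "g r = d * f r"
    using fpos[OF s(1)] fpos[OF r(1)] by (auto simp: c_def d_def)
  have ub: "g t \<le> c * f t" and lb: "d * f t \<le> g t" if "t \<in> {0..1}" for t
    using s(2)[OF that] r(2)[OF that] fpos[OF that]
    by (auto simp: c_def[symmetric] d_def[symmetric] pos_divide_le_eq pos_le_divide_eq)
  \<comment> \<open>The common value 1 at \<open>0\<close> forces \<open>e = 1\<close>, that is,
    equality of \<open>f\<close> and \<open>g\<close>.\<close>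
  have not_prop: "\<not> (\<forall>t\<in>{0..1}. g t = e * f t)" for e
  proof
    assume *: "\<forall>t\<in>{0..1}. g t = e * f t"
    then have "e = 1" using f0 g0 by force
    then show False using * ne by auto
  qed
  \<comment> \<open>The explicit factor 1 matches the shape in \<open>W_diff_scale\<close>.\<close>
  have "(\<lambda>t. c * f t - 1 * g t) \<in> C0_plus"
    using cf cg ub not_prop[of c] unfolding C0_plus_def by (force intro!: continuous_intros)
  \<comment> \<open>The function built from the maximum \<open>c\<close> is tested at the minimum
    point \<open>r\<close>, and below the one built from \<open>d\<close> at the maximum point
    \<open>s\<close>; this crossing makes the same product \<open>a * c * d\<close> appear in both
    inequalities.\<close>
  from pos[OF this r(1)] have "b * f r < c * (a * (d * f r))"
    using W_diff_scale[OF acts cf cg r(1), of c 1] Wf[OF r(1)] Wg[OF r(1)] gr by simp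
  then have 1: "b < a * c * d"
    using fpos[OF r(1)] mult_less_cancel_right_pos[of "f r" b "a * c * d"] by (simp add: mult_ac)
  have "(\<lambda>t. 1 * g t - d * f t) \<in> C0_plus"
    using cf cg lb not_prop[of d] unfolding C0_plus_def by (force intro!: continuous_intros)
  from pos[OF this s(1)] have "d * (a * (c * f s)) < b * f s"
    using W_diff_scale[OF acts cg cf s(1), of 1 d] Wf[OF s(1)] Wg[OF s(1)] gs by simp
  then have 2: "a * c * d < b"
    using fpos[OF s(1)] mult_less_cancel_right_pos[of "f s" "a * c * d" b] by (simp add: mult_ac)
  from 1 2 show False by simp
qed

end
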